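(* Let $S=(S_0,S_T)$ be a traded asset and $\alpha\in(0,1)$. The following statements are equivalent: (a) $\rho_{\mathscr{A}^\alpha,S}$ is finitely valued; (b) $\mathrm{TVaR}_\alpha(S_T)<0$; (c) $\mathbb{P}[S_T=0]<\alpha$.
   Context: Let $(\Omega,\mathcal{F},\mathbb{P})$ be a probability space and $\mathscr{X}$ the Banach space of bounded $\mathcal{F}$-measurable functions $X:\Omega\to\mathbb{R}$ with the supremum norm and the pointwise order (functions are not identified almost surely); $\mathscr{X}_+=\{X\in\mathscr{X}: X\ge 0\}$. For $\beta\in(0,1)$ and $X\in\mathscr{X}$, $\mathrm{VaR}_\beta(X)=\inf\{m\in\mathbb{R}:\mathbb{P}[X+m<0]\le\beta\}$. For $\alpha\in(0,1)$, $\mathrm{TVaR}_\alpha(X)=\frac1\alpha\int_0^\alpha\mathrm{VaR}_\beta(X)\,d\beta$, and $\mathscr{A}^\alpha=\{X\in\mathscr{X}:\mathrm{TVaR}_\alpha(X)\le 0\}$. A traded asset is a pair $S=(S_0,S_T)$ with $S_0\in\mathbb{R}$, $S_0>0$, and $S_T\in\mathscr{X}_+$, $S_T\ne 0$. For $\mathscr{A}\subset\mathscr{X}$, $\rho_{\mathscr{A},S}:\mathscr{X}\to\mathbb{R}\cup\{-\infty,\infty\}$ is $\rho_{\mathscr{A},S}(X)=\inf\{m\in\mathbb{R}: X+\frac{m}{S_0}S_T\in\mathscr{A}\}$ (with $\inf\emptyset=\infty$). It is finitely valued if $\rho_{\mathscr{A},S}(X)\in\mathbb{R}$ for every $X\in\mathscr{X}$.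 *)

theory Defs
  imports "HOL-Probability.Probability"
begin

text \<open>
  The positions live on \<open>space M\<close>, and only their values there matter: all conditions below are
  relativised to \<open>space M\<close>, pointwise and not almost everywhere, so that functions are not
  identified almost surely.
\<close>

definition positions :: "'a measure \<Rightarrow> ('a \<Rightarrow> real) set" where
  "positions M = {X \<in> borel_measurable M. bounded (X ` space M)}"

definition positions_nonneg :: "'a measure \<Rightarrow> ('a \<Rightarrow> real) set" where
  "positions_nonneg M = {X \<in> positions M. \<forall>\<omega>\<in>space M. 0 \<le> X \<omega>}"

text \<open>
  For a probability space, bounded \<open>X\<close> and \<open>0 < \<beta> < 1\<close> the set below is nonempty and bounded
  below, so the real-valued infimum is the true one.
\<close>

definition VaR :: "'a measure \<Rightarrow> real \<Rightarrow> ('a \<Rightarrow> real) \<Rightarrow> real" where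
  "VaR M \<beta> X = Inf {m. \<P>(\<omega> in M. X \<omega> + m < 0) \<le> \<beta>}"

text \<open>
  The open interval avoids \<open>VaR\<close> at level \<open>0\<close>. On it, \<open>VaR M \<beta> X\<close> is bounded and
  nonincreasing in \<open>\<beta>\<close> (for bounded \<open>X\<close> and \<open>\<alpha> < 1\<close>), so the integral exists.
\<close>

definition TVaR :: "'a measure \<Rightarrow> real \<Rightarrow> ('a \<Rightarrow> real) \<Rightarrow> real" where
  "TVaR M \<alpha> X = 1 / \<alpha> * (LBINT \<beta>:{0<..<\<alpha>}. VaR M \<beta> X)"

definition TVaR_acceptance :: "'a measure \<Rightarrow> real \<Rightarrow> ('a \<Rightarrow> real) set" where
  "TVaR_acceptance M \<alpha> = {X \<in> positions M. TVaR M \<alpha> X \<le> 0}"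

definition traded_asset :: "'a measure \<Rightarrow> real \<times> ('a \<Rightarrow> real) \<Rightarrow> bool" where
  "traded_asset M S \<longleftrightarrow>
     fst S > 0 \<and> snd S \<in> positions_nonneg M \<and> (\<exists>\<omega>\<in>space M. snd S \<omega> \<noteq> 0)"

text \<open>The infimum is taken in \<open>ereal\<close>, where \<open>Inf {} = \<infinity>\<close>.\<close>

definition risk_measure ::
    "('a \<Rightarrow> real) set \<Rightarrow> real \<times> ('a \<Rightarrow> real) \<Rightarrow> ('a \<Rightarrow> real) \<Rightarrow> ereal" where
  "risk_measure A S X = Inf {ereal m | m. (\<lambda>\<omega>. X \<omega> + m / fst S * snd S \<omega>) \<in> A}"

definition finitely_valued :: "'a measure \<Rightarrow> (('a \<Rightarrow> real) \<Rightarrow> ereal) \<Rightarrow> bool" where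
  "finitely_valued M \<rho> \<longleftrightarrow> (\<forall>X\<in>positions M. \<bar>\<rho> X\<bar> \<noteq> \<infinity>)"

end

theory Submission
  imports Defs
begin

text \<open>
  If \<open>X \<ge> -K\<close> everywhere and \<open>X \<ge> -b\<close> outside an event of probability at most \<open>p\<close>, then
  \<open>VaR\<close> is at most the step function equal to \<open>K\<close> on \<open>(0,p)\<close> and to \<open>b\<close> on \<open>[p,\<alpha>)\<close>; dually
  from below. Integrating these two bounds gives everything. If \<open>P[S\<^sub>T = 0] < \<alpha>\<close>, then
  \<open>p = P[S\<^sub>T < \<epsilon>] < \<alpha>\<close> for some \<open>\<epsilon> > 0\<close>, and the upper bound makes \<open>TVaR\<close> of \<open>S\<^sub>T\<close>
  negative and \<open>X + c S\<^sub>T\<close> acceptable for large \<open>c\<close>, while the lower bound on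
  \<open>{S\<^sub>T \<ge> \<epsilon>}\<close>, which has positive probability, makes it unacceptable for large negative \<open>c\<close>.
  If \<open>P[S\<^sub>T = 0] \<ge> \<alpha>\<close>, then on \<open>{S\<^sub>T = 0}\<close> the asset contributes nothing, so the lower bound
  gives \<open>TVaR\<close> of \<open>S\<^sub>T\<close> nonnegative and leaves \<open>-1 + c S\<^sub>T\<close> unacceptable for every \<open>c\<close>.
\<close>

section \<open>Bounded positions and their combinations\<close>

lemma positionsE:
  assumes "X \<in> positions M"
  obtains K where "K > 0" "\<And>\<omega>. \<omega> \<in> space M \<Longrightarrow> \<bar>X \<omega>\<bar> \<le> K"
  using assms unfolding positions_def bounded_pos by auto

lemma positions_measurable: "X \<in> positions M \<Longrightarrow> X \<in> borel_measurable M"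
  by (simp add: positions_def)

lemma positions_const: "(\<lambda>_. c) \<in> positions M"
  by (auto simp: positions_def bounded_iff)

lemma positions_add_scaled:
  assumes "X \<in> positions M" "Y \<in> positions M"
  shows "(\<lambda>\<omega>. X \<omega> + c * Y \<omega>) \<in> positions M"
proof -
  obtain K L where K: "\<And>\<omega>. \<omega> \<in> space M \<Longrightarrow> \<bar>X \<omega>\<bar> \<le> K"
    and L: "\<And>\<omega>. \<omega> \<in> space M \<Longrightarrow> \<bar>Y \<omega>\<bar> \<le> L"
    using assms by (metis positionsE)
  have "\<bar>X \<omega> + c * Y \<omega>\<bar> \<le> K + \<bar>c\<bar> * L" if "\<omega> \<in> space M" for \<omega>
    using K[OF that] mult_left_mono[OF L[OF that], of "\<bar>c\<bar>"]
    by (intro order_trans[OF abs_triangle_ineq]) (simp add: abs_mult)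
  then have "bounded ((\<lambda>\<omega>. X \<omega> + c * Y \<omega>) ` space M)"
    by (auto simp: bounded_iff)
  with assms show ?thesis
    by (auto simp: positions_def intro!: borel_measurable_add borel_measurable_times)
qed

section \<open>Integrals of two-valued step functions\<close>

lemma integrable_indicator_Ioo: "integrable lborel (indicator {a<..<b::real} :: real \<Rightarrow> real)"
  by (cases "a \<le> b") (simp_all add: integrable_indicator_iff)

lemma step_function_set_integral:
  fixes a b p \<alpha> :: real
  assumes "0 \<le> p" "p \<le> \<alpha>"
  shows "set_integrable lborel {0<..<\<alpha>} (\<lambda>\<beta>. if \<beta> < p then a else b)"
    and "(LBINT \<beta>:{0<..<\<alpha>}. if \<beta> < p then a else b) = a * p + b * (\<alpha> - p)"
proof -
  \<comment> \<open>The step function is the constant \<open>b\<close> on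
    \<open>(0,\<alpha>)\<close> plus a correction \<open>a - b\<close> on
    \<open>(0,p)\<close>.\<close>
  have eq: "(\<lambda>\<beta>. indicator {0<..<\<alpha>} \<beta> *\<^sub>R (if \<beta> < p then a else b)) =
      (\<lambda>\<beta>. b * indicator {0<..<\<alpha>} \<beta> + (a - b) * indicator {0<..<p} \<beta>)"
    using assms by (auto simp: indicator_def)
  show "set_integrable lborel {0<..<\<alpha>} (\<lambda>\<beta>. if \<beta> < p then a else b)"
    unfolding set_integrable_def eq
    by (intro Bochner_Integration.integrable_add integrable_mult_right integrable_indicator_Ioo)
  have "(LBINT \<beta>:{0<..<\<alpha>}. if \<beta> < p then a else b) = b * \<alpha> + (a - b) * p"
    unfolding set_lebesgue_integral_def eq using assms
    by (simp add: integrable_indicator_Ioo)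
  also have "\<dots> = a * p + b * (\<alpha> - p)"
    by algebra
  finally show "(LBINT \<beta>:{0<..<\<alpha>}. if \<beta> < p then a else b) = a * p + b * (\<alpha> - p)" .
qed

section \<open>Value at risk: bounds and integrability in the level\<close>

context prob_space
begin

text \<open>For \<open>m\<close> below \<open>- K\<close>, where \<open>K\<close> bounds
  \<open>\<bar>X\<bar>\<close>, the event is all of \<open>space M\<close> and has probability 1,
  which exceeds \<beta>.\<close>

lemma VaR_bdd_below:
  assumes "X \<in> positions M" "\<beta> < 1"
  shows "bdd_below {m. \<P>(\<omega> in M. X \<omega> + m < 0) \<le> \<beta>}"
proof -
  obtain K where K: "\<And>\<omega>. \<omega> \<in> space M \<Longrightarrow> \<bar>X \<omega>\<bar> \<le> K"
    using assms(1) by (metis positionsE)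
  have "- K \<le> m" if "\<P>(\<omega> in M. X \<omega> + m < 0) \<le> \<beta>" for m
  proof (rule ccontr)
    assume "\<not> - K \<le> m"
    then have "{\<omega> \<in> space M. X \<omega> + m < 0} = space M"
      using K by fastforce
    with that assms(2) prob_space show False
      by simp
  qed
  then show ?thesis
    by (intro bdd_belowI[of _ "- K"]) simp
qed

lemma VaR_le:
  assumes "X \<in> positions M" "\<beta> < 1" "\<P>(\<omega> in M. X \<omega> + m < 0) \<le> \<beta>"
  shows "VaR M \<beta> X \<le> m"
  unfolding VaR_def using assms by (intro cInf_lower VaR_bdd_below) auto

lemma VaR_le_bound:
  assumes "X \<in> positions M" "0 \<le> \<beta>" "\<beta> < 1" "\<And>\<omega>. \<omega> \<in> space M \<Longrightarrow> - K \<le> X \<omega>"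
  shows "VaR M \<beta> X \<le> K"
proof (rule VaR_le)
  have "{\<omega> \<in> space M. X \<omega> + K < 0} = {}"
    using assms(4) by fastforce
  with \<open>0 \<le> \<beta>\<close> show "\<P>(\<omega> in M. X \<omega> + K < 0) \<le> \<beta>"
    by (simp only: measure_empty)
qed (use assms in auto)

lemma VaR_set_nonempty:
  assumes "X \<in> positions M" "0 \<le> \<beta>"
  shows "{m. \<P>(\<omega> in M. X \<omega> + m < 0) \<le> \<beta>} \<noteq> {}"
proof -
  obtain K where K: "\<And>\<omega>. \<omega> \<in> space M \<Longrightarrow> \<bar>X \<omega>\<bar> \<le> K"
    using assms(1) by (metis positionsE)
  have "{\<omega> \<in> space M. X \<omega> + K < 0} = {}"
    using K by fastforce
  with \<open>0 \<le> \<beta>\<close> have "\<P>(\<omega> in M. X \<omega> + K < 0) \<le> \<beta>"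
    by (simp only: measure_empty)
  then show ?thesis
    by blast
qed

text \<open>If \<open>m < b\<close>, the event \<open>X \<le> - b\<close> lies inside
  \<open>X + m < 0\<close>, so the latter is too likely for \<open>m\<close> to be admissible. The
  inequality on \<beta> is strict because admissibility is defined with \<le>.\<close>

lemma VaR_ge:
  assumes "X \<in> positions M" "0 \<le> \<beta>" "\<beta> < \<P>(\<omega> in M. X \<omega> \<le> - b)"
  shows "b \<le> VaR M \<beta> X"
  unfolding VaR_def
proof (intro cInf_greatest VaR_set_nonempty)
  fix m assume "m \<in> {m. \<P>(\<omega> in M. X \<omega> + m < 0) \<le> \<beta>}"
  then have m: "\<P>(\<omega> in M. X \<omega> + m < 0) \<le> \<beta>"
    by simp
  show "b \<le> m"
  proof (rule ccontr)
    assume "\<not> b \<le> m"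
    then have "\<P>(\<omega> in M. X \<omega> \<le> - b) \<le> \<P>(\<omega> in M. X \<omega> + m < 0)"
      using positions_measurable[OF assms(1)] by (intro finite_measure_mono) auto
    with m assms(3) show False
      by simp
  qed
qed (use assms in auto)

lemma VaR_ge_bound:
  assumes "X \<in> positions M" "0 \<le> \<beta>" "\<beta> < 1" "\<And>\<omega>. \<omega> \<in> space M \<Longrightarrow> X \<omega> \<le> K"
  shows "- K \<le> VaR M \<beta> X"
proof (rule VaR_ge)
  have "{\<omega> \<in> space M. X \<omega> \<le> - (- K)} = space M"
    using assms(4) by auto
  with \<open>\<beta> < 1\<close> prob_space show "\<beta> < \<P>(\<omega> in M. X \<omega> \<le> - (- K))"
    by simp
qed (use assms in auto)

text \<open>Raising the level enlarges the set of admissible \<open>m\<close>, so its infimum can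
  only drop.\<close>

lemma VaR_antimono:
  assumes "X \<in> positions M" "0 \<le> \<beta>" "\<beta> \<le> \<gamma>" "\<gamma> < 1"
  shows "VaR M \<gamma> X \<le> VaR M \<beta> X"
  unfolding VaR_def using assms
  by (intro cInf_superset_mono VaR_set_nonempty VaR_bdd_below) auto

lemma VaR_set_integrable:
  assumes X: "X \<in> positions M" and "\<alpha> < 1"
  shows "set_integrable lborel {0<..<\<alpha>} (\<lambda>\<beta>. VaR M \<beta> X)"
proof -
  obtain K where K: "\<And>\<omega>. \<omega> \<in> space M \<Longrightarrow> \<bar>X \<omega>\<bar> \<le> K"
    using X by (metis positionsE)
  \<comment> \<open>Negation makes the function nondecreasing; measurability then follows from
    monotonicity alone.\<close>
  have "mono_on {0<..<\<alpha>} (\<lambda>\<beta>. - VaR M \<beta> X)"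
    using VaR_antimono[OF X] \<open>\<alpha> < 1\<close> by (auto simp: mono_on_def)
  then have "(\<lambda>\<beta>. - VaR M \<beta> X) \<in> borel_measurable (restrict_space borel {0<..<\<alpha>})"
    by (rule borel_measurable_mono_on_fnc)
  from borel_measurable_uminus[OF this]
  have "(\<lambda>\<beta>. VaR M \<beta> X) \<in> borel_measurable (restrict_space borel {0<..<\<alpha>})"
    by simp
  then have meas: "set_borel_measurable lborel {0<..<\<alpha>} (\<lambda>\<beta>. VaR M \<beta> X)"
    unfolding set_borel_measurable_def
    by (subst (asm) borel_measurable_restrict_space_iff) auto
  show ?thesis
  proof (rule set_integrable_bound[OF _ meas])
    show "set_integrable lborel {0<..<\<alpha>} (\<lambda>_. K)"
      unfolding set_integrable_def using integrable_indicator_Ioo by simp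
    have "\<bar>VaR M \<beta> X\<bar> \<le> K" if "\<beta> \<in> {0<..<\<alpha>}" for \<beta>
      using that \<open>\<alpha> < 1\<close> K VaR_le_bound[OF X, of \<beta> K] VaR_ge_bound[OF X, of \<beta> K]
      by (fastforce simp: abs_le_iff)
    then show "AE \<beta> in lborel. \<beta> \<in> {0<..<\<alpha>} \<longrightarrow> norm (VaR M \<beta> X) \<le> norm K"
      by fastforce
  qed
qed

section \<open>Two-sided estimates of TVaR by step functions\<close>

lemma TVaR_le_step:
  assumes X: "X \<in> positions M" and \<alpha>: "0 < \<alpha>" "\<alpha> < 1" and p: "0 \<le> p" "p \<le> \<alpha>"
    and K: "\<And>\<omega>. \<omega> \<in> space M \<Longrightarrow> - K \<le> X \<omega>"
    and b: "\<P>(\<omega> in M. X \<omega> + b < 0) \<le> p"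
  shows "\<alpha> * TVaR M \<alpha> X \<le> K * p + b * (\<alpha> - p)"
proof -
  have "\<alpha> * TVaR M \<alpha> X = (LBINT \<beta>:{0<..<\<alpha>}. VaR M \<beta> X)"
    using \<alpha> by (simp add: TVaR_def)
  also have "\<dots> \<le> (LBINT \<beta>:{0<..<\<alpha>}. if \<beta> < p then K else b)"
  proof (rule set_integral_mono)
    \<comment> \<open>Below \<open>p\<close> only the uniform bound is available; from
      \<open>p\<close> on, the exceptional event has probability at most
      \<open>p \<le> \<beta>\<close>, so \<open>b\<close> is admissible.\<close>
    fix \<beta> assume "\<beta> \<in> {0<..<\<alpha>}"
    then show "VaR M \<beta> X \<le> (if \<beta> < p then K else b)"
      using VaR_le_bound[OF X, of \<beta> K] VaR_le[OF X, of \<beta> b] K b \<alpha> by auto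
  qed (use VaR_set_integrable[OF X] step_function_set_integral(1) \<alpha> p in auto)
  finally show ?thesis
    using p by (simp add: step_function_set_integral)
qed

lemma TVaR_ge_step:
  assumes X: "X \<in> positions M" and \<alpha>: "0 < \<alpha>" "\<alpha> < 1" and q: "0 \<le> q" "q \<le> \<alpha>"
    and K: "\<And>\<omega>. \<omega> \<in> space M \<Longrightarrow> X \<omega> \<le> K"
    and b: "q \<le> \<P>(\<omega> in M. X \<omega> \<le> - b)"
  shows "b * q - K * (\<alpha> - q) \<le> \<alpha> * TVaR M \<alpha> X"
proof -
  have "b * q - K * (\<alpha> - q) = (LBINT \<beta>:{0<..<\<alpha>}. if \<beta> < q then b else - K)"
    using q by (simp add: step_function_set_integral)
  also have "\<dots> \<le> (LBINT \<beta>:{0<..<\<alpha>}. VaR M \<beta> X)"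
  proof (rule set_integral_mono)
    \<comment> \<open>Below \<open>q\<close> the level is strictly less than the probability of
      \<open>X \<le> - b\<close>, which forces \<open>b\<close>; elsewhere the uniform bound is
      used.\<close>
    fix \<beta> assume "\<beta> \<in> {0<..<\<alpha>}"
    then show "(if \<beta> < q then b else - K) \<le> VaR M \<beta> X"
      using VaR_ge_bound[OF X, of \<beta> K] VaR_ge[OF X, of \<beta> b] K b \<alpha> by auto
  qed (use VaR_set_integrable[OF X] step_function_set_integral(1) \<alpha> q in auto)
  also have "\<dots> = \<alpha> * TVaR M \<alpha> X"
    using \<alpha> by (simp add: TVaR_def)
  finally show ?thesis .
qed

text \<open>The events \<open>Y < 1/(n+1)\<close> decrease to \<open>Y = 0\<close>, so continuity
  from above brings their probabilities below \<alpha>.\<close>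

lemma prob_eq_zero_lt_imp_prob_small_lt:
  assumes Y: "Y \<in> borel_measurable M" and nonneg: "\<And>\<omega>. \<omega> \<in> space M \<Longrightarrow> (0::real) \<le> Y \<omega>"
    and lt: "\<P>(\<omega> in M. Y \<omega> = 0) < \<alpha>"
  obtains \<epsilon> where "\<epsilon> > 0" "\<P>(\<omega> in M. Y \<omega> < \<epsilon>) < \<alpha>"
proof -
  define A where "A n = {\<omega> \<in> space M. Y \<omega> < inverse (real (Suc n))}" for n
  have Inter: "(\<Inter>n. A n) = {\<omega> \<in> space M. Y \<omega> = 0}"
  proof (intro set_eqI iffI)
    fix \<omega> assume *: "\<omega> \<in> (\<Inter>n. A n)"
    then have "\<omega> \<in> space M" "\<And>n. Y \<omega> < inverse (real (Suc n))"
      by (auto simp: A_def)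
    moreover from this have "\<not> 0 < Y \<omega>"
      using reals_Archimedean[of "Y \<omega>"] by (meson less_asym)
    ultimately show "\<omega> \<in> {\<omega> \<in> space M. Y \<omega> = 0}"
      using nonneg[of \<omega>] by simp
  qed (auto simp: A_def)
  have "(\<lambda>n. measure M (A n)) \<longlonglongrightarrow> measure M (\<Inter>n. A n)"
  proof (rule finite_Lim_measure_decseq)
    show "range A \<subseteq> sets M"
      using Y by (auto simp: A_def)
    show "decseq A"
      unfolding A_def
      by (intro decseq_SucI) (auto elim!: less_le_trans intro!: le_imp_inverse_le)
  qed
  then have "\<forall>\<^sub>F n in sequentially. measure M (A n) < \<alpha>"
    using lt by (intro order_tendstoD(2)[where y = "measure M (\<Inter>n. A n)"]) (simp_all add: Inter)
  then obtain n where "measure M (A n) < \<alpha>"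
    by (auto simp: eventually_sequentially)
  then show thesis
    by (intro that[of "inverse (real (Suc n))"]) (simp_all add: A_def)
qed

end

text \<open>A multiple \<open>c\<close> of \<open>Y\<close> costs \<open>c * s\<close>. One
  acceptable multiple bounds the infimum from above, and a common lower bound for all acceptable
  multiples bounds it from below.\<close>

lemma risk_measure_finite:
  assumes acc: "(\<lambda>\<omega>. X \<omega> + c * Y \<omega>) \<in> A"
    and bound: "\<And>c. (\<lambda>\<omega>. X \<omega> + c * Y \<omega>) \<in> A \<Longrightarrow> - d \<le> c"
    and s: "s > 0"
  shows "\<bar>risk_measure A (s, Y) X\<bar> \<noteq> \<infinity>"
proof -
  have "risk_measure A (s, Y) X \<le> ereal (c * s)"
    unfolding risk_measure_def using acc s by (intro Inf_lower) force
  moreover have "ereal (- d * s) \<le> risk_measure A (s, Y) X"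
    unfolding risk_measure_def
  proof (rule Inf_greatest)
    fix z assume "z \<in> {ereal m |m. (\<lambda>\<omega>. X \<omega> + m / fst (s, Y) * snd (s, Y) \<omega>) \<in> A}"
    then obtain m where "z = ereal m" "- d \<le> m / s"
      using bound by auto
    then show "ereal (- d * s) \<le> z"
      using s by (simp add: pos_le_divide_eq)
  qed
  ultimately show ?thesis
    by (cases "risk_measure A (s, Y) X") auto
qed

section \<open>The equivalence, by cases on the probability of a zero payoff\<close>

theorem proposition3p9:
  fixes M :: "'a measure" and S :: "real \<times> ('a \<Rightarrow> real)" and \<alpha> :: real
  assumes "prob_space M"
    and "traded_asset M S"
    and "0 < \<alpha>" and "\<alpha> < 1"
  shows "(finitely_valued M (risk_measure (TVaR_acceptance M \<alpha>) S) \<longleftrightarrow> TVaR M \<alpha> (snd S) < 0) \<and>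
         (TVaR M \<alpha> (snd S) < 0 \<longleftrightarrow> \<P>(\<omega> in M. snd S \<omega> = 0) < \<alpha>)"
proof -
  interpret prob_space M by fact
  note \<alpha> = \<open>0 < \<alpha>\<close> \<open>\<alpha> < 1\<close>
  obtain s Y where S: "S = (s, Y)"
    by (cases S)
  have s: "s > 0" and Y: "Y \<in> positions M" and nonneg: "\<And>\<omega>. \<omega> \<in> space M \<Longrightarrow> 0 \<le> Y \<omega>"
    using assms(2) by (auto simp: S traded_asset_def positions_nonneg_def)
  have Ym [measurable]: "Y \<in> borel_measurable M"
    using Y by (rule positions_measurable)
  obtain L where L: "L > 0" "\<And>\<omega>. \<omega> \<in> space M \<Longrightarrow> \<bar>Y \<omega>\<bar> \<le> L"
    using Y by (metis positionsE)
  show ?thesis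
  \<comment> \<open>All three statements hold in the first case and all three fail in the
    second.\<close>
  proof (cases "\<P>(\<omega> in M. Y \<omega> = 0) < \<alpha>")
    case True
    then obtain \<epsilon> where \<epsilon>: "\<epsilon> > 0" "\<P>(\<omega> in M. Y \<omega> < \<epsilon>) < \<alpha>"
      using prob_eq_zero_lt_imp_prob_small_lt[OF Ym nonneg] by metis
    define p where "p = \<P>(\<omega> in M. Y \<omega> < \<epsilon>)"
    have p: "0 \<le> p" "p < \<alpha>"
      using \<epsilon> by (simp_all add: p_def)
    have "\<alpha> * TVaR M \<alpha> Y \<le> 0 * p + (- \<epsilon>) * (\<alpha> - p)"
      using p nonneg by (intro TVaR_le_step[OF Y \<alpha>]) (auto simp: p_def)
    also have "\<dots> < 0"
      using \<epsilon> p by simp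
    finally have neg: "TVaR M \<alpha> Y < 0"
      using \<alpha> by (simp add: mult_less_0_iff)
    \<comment> \<open>The probability of \<open>Y \<ge> \<epsilon>\<close>, capped at \<alpha> to
      fit the range of integration; it is positive since \<open>p < \<alpha> < 1\<close>.\<close>
    define q where "q = min (1 - p) \<alpha>"
    have q: "0 < q" "q \<le> \<alpha>"
      using p \<alpha> by (auto simp: q_def)
    have "\<P>(\<omega> in M. Y \<omega> \<ge> \<epsilon>) = 1 - p"
      unfolding p_def by (subst prob_neg[symmetric]) (auto simp: not_less)
    then have q_le: "q \<le> \<P>(\<omega> in M. Y \<omega> \<ge> \<epsilon>)"
      by (simp add: q_def)
    have "finitely_valued M (risk_measure (TVaR_acceptance M \<alpha>) (s, Y))"
      unfolding finitely_valued_def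
    proof
      fix X assume X: "X \<in> positions M"
      then have [measurable]: "X \<in> borel_measurable M"
        by (rule positions_measurable)
      obtain K where K: "K > 0" "\<And>\<omega>. \<omega> \<in> space M \<Longrightarrow> \<bar>X \<omega>\<bar> \<le> K"
        using X by (metis positionsE)
      have XY: "(\<lambda>\<omega>. X \<omega> + c * Y \<omega>) \<in> positions M" for c
        using X Y by (rule positions_add_scaled)
      \<comment> \<open>Chosen so that the upper bound
        \<open>K * p + (K - c * \<epsilon>) * (\<alpha> - p)\<close> is exactly 0.\<close>
      define c where "c = K * \<alpha> / (\<epsilon> * (\<alpha> - p))"
      have c: "c > 0"
        using K \<epsilon> p \<alpha> by (simp add: c_def)
      have "\<alpha> * TVaR M \<alpha> (\<lambda>\<omega>. X \<omega> + c * Y \<omega>) \<le> K * p + (K - c * \<epsilon>) * (\<alpha> - p)"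
      proof (rule TVaR_le_step[OF XY \<alpha>])
        fix \<omega> assume \<omega>: "\<omega> \<in> space M"
        then have "0 \<le> c * Y \<omega>"
          using c nonneg by simp
        then show "- K \<le> X \<omega> + c * Y \<omega>"
          using K(2)[OF \<omega>] by simp
      next
        \<comment> \<open>Since \<open>X \<ge> - K\<close>, a value below
          \<open>c * \<epsilon> - K\<close> can occur only where the payoff is below
          \<epsilon>.\<close>
        have "Y \<omega> < \<epsilon>" if "\<omega> \<in> space M" "X \<omega> + c * Y \<omega> + (K - c * \<epsilon>) < 0" for \<omega>
        proof -
          have "c * Y \<omega> < c * \<epsilon>"
            using that K(2)[OF that(1)] by simp
          then show ?thesis
            using c by simp
        qed
        then show "\<P>(\<omega> in M. X \<omega> + c * Y \<omega> + (K - c * \<epsilon>) < 0) \<le> p"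
          unfolding p_def by (intro finite_measure_mono) auto
      qed (use p in auto)
      also have "\<dots> = K * \<alpha> - c * (\<epsilon> * (\<alpha> - p))"
        by algebra
      also have "\<dots> = 0"
        using \<epsilon> p by (simp add: c_def)
      finally have acc: "(\<lambda>\<omega>. X \<omega> + c * Y \<omega>) \<in> TVaR_acceptance M \<alpha>"
        using XY \<alpha> by (simp add: TVaR_acceptance_def mult_le_0_iff)
      \<comment> \<open>The zero of the lower bound
        \<open>(d * \<epsilon> - K) * q - K * (\<alpha> - q)\<close>; any multiple below
        \<open>- d\<close> makes the bound positive and contradicts acceptability.\<close>
      define d where "d = K * \<alpha> / (\<epsilon> * q)"
      have d: "d > 0"
        using K \<epsilon> q \<alpha> by (simp add: d_def)
      have "- d \<le> e" if e: "(\<lambda>\<omega>. X \<omega> + e * Y \<omega>) \<in> TVaR_acceptance M \<alpha>" for e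
      proof (rule ccontr)
        assume "\<not> - d \<le> e"
        then have "e < - d" "e < 0"
          using d by auto
        have "(- e * \<epsilon> - K) * q - K * (\<alpha> - q) \<le> \<alpha> * TVaR M \<alpha> (\<lambda>\<omega>. X \<omega> + e * Y \<omega>)"
        proof (rule TVaR_ge_step[OF XY \<alpha>])
          fix \<omega> assume \<omega>: "\<omega> \<in> space M"
          then have "e * Y \<omega> \<le> 0"
            using \<open>e < 0\<close> nonneg by (simp add: mult_le_0_iff)
          then show "X \<omega> + e * Y \<omega> \<le> K"
            using K(2)[OF \<omega>] by simp
        next
          have "X \<omega> + e * Y \<omega> \<le> - (- e * \<epsilon> - K)" if "\<omega> \<in> space M" "\<epsilon> \<le> Y \<omega>" for \<omega>
          proof -
            have "e * Y \<omega> \<le> e * \<epsilon>"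
              using \<open>e < 0\<close> that(2) by (intro mult_left_mono_neg) auto
            then show ?thesis
              using K(2)[OF that(1)] by simp
          qed
          then have "\<P>(\<omega> in M. Y \<omega> \<ge> \<epsilon>) \<le> \<P>(\<omega> in M. X \<omega> + e * Y \<omega> \<le> - (- e * \<epsilon> - K))"
            by (intro finite_measure_mono) auto
          with q_le show "q \<le> \<P>(\<omega> in M. X \<omega> + e * Y \<omega> \<le> - (- e * \<epsilon> - K))"
            by simp
        qed (use q in auto)
        moreover have "\<alpha> * TVaR M \<alpha> (\<lambda>\<omega>. X \<omega> + e * Y \<omega>) \<le> 0"
          using e \<alpha> by (simp add: TVaR_acceptance_def mult_le_0_iff)
        ultimately have "- e * (\<epsilon> * q) \<le> K * \<alpha>"
          by (simp add: algebra_simps)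
        moreover have "d * (\<epsilon> * q) < - e * (\<epsilon> * q)"
          using \<open>e < - d\<close> \<epsilon> q by (intro mult_strict_right_mono) auto
        moreover have "d * (\<epsilon> * q) = K * \<alpha>"
          using \<epsilon> q by (simp add: d_def)
        ultimately show False
          by simp
      qed
      with acc s show "\<bar>risk_measure (TVaR_acceptance M \<alpha>) (s, Y) X\<bar> \<noteq> \<infinity>"
        by (intro risk_measure_finite)
    qed
    with neg True show ?thesis
      by (simp add: S)
  next
    case False
    \<comment> \<open>Taking \<open>q = \<alpha>\<close> annihilates the term with the uniform upper
      bound.\<close>
    have "0 * \<alpha> - L * (\<alpha> - \<alpha>) \<le> \<alpha> * TVaR M \<alpha> Y"
    proof (rule TVaR_ge_step[OF Y \<alpha>])
      have "\<P>(\<omega> in M. Y \<omega> = 0) \<le> \<P>(\<omega> in M. Y \<omega> \<le> - 0)"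
        by (intro finite_measure_mono) auto
      with False show "\<alpha> \<le> \<P>(\<omega> in M. Y \<omega> \<le> - 0)"
        by simp
    qed (use \<alpha> L in \<open>auto simp: abs_le_iff\<close>)
    then have nonneg_TVaR: "\<not> TVaR M \<alpha> Y < 0"
      using \<alpha> by (simp add: zero_le_mult_iff)
    \<comment> \<open>Where \<open>Y = 0\<close> the value stays at \<open>- 1\<close> for every
      \<open>c\<close>, with probability at least \<alpha>. So TVaR is at least 1, however large the
      payoff is elsewhere.\<close>
    have "(\<lambda>\<omega>. - 1 + c * Y \<omega>) \<notin> TVaR_acceptance M \<alpha>" for c
    proof -
      have "1 * \<alpha> - (\<bar>c\<bar> * L) * (\<alpha> - \<alpha>) \<le> \<alpha> * TVaR M \<alpha> (\<lambda>\<omega>. - 1 + c * Y \<omega>)"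
      proof (rule TVaR_ge_step[OF positions_add_scaled[OF positions_const Y] \<alpha>])
        fix \<omega> assume \<omega>: "\<omega> \<in> space M"
        have "c * Y \<omega> \<le> \<bar>c\<bar> * \<bar>Y \<omega>\<bar>"
          by (metis abs_ge_self abs_mult)
        also have "\<dots> \<le> \<bar>c\<bar> * L"
          using L(2)[OF \<omega>] by (intro mult_left_mono) auto
        finally show "- 1 + c * Y \<omega> \<le> \<bar>c\<bar> * L"
          by simp
      next
        have "\<P>(\<omega> in M. Y \<omega> = 0) \<le> \<P>(\<omega> in M. - 1 + c * Y \<omega> \<le> - 1)"
          by (intro finite_measure_mono) auto
        with False show "\<alpha> \<le> \<P>(\<omega> in M. - 1 + c * Y \<omega> \<le> - 1)"
          by simp
      qed (use \<alpha> in auto)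
      then have "0 < \<alpha> * TVaR M \<alpha> (\<lambda>\<omega>. - 1 + c * Y \<omega>)"
        using \<alpha> by simp
      then show ?thesis
        using \<alpha> by (simp add: TVaR_acceptance_def zero_less_mult_iff)
    qed
    then have "{ereal m |m. (\<lambda>\<omega>. - 1 + m / s * Y \<omega>) \<in> TVaR_acceptance M \<alpha>} = {}"
      by blast
    \<comment> \<open>No amount is acceptable, and the infimum of the empty set in
      \<open>ereal\<close> is \<infinity>.\<close>
    then have "risk_measure (TVaR_acceptance M \<alpha>) (s, Y) (\<lambda>_. - 1) = \<infinity>"
      by (simp only: risk_measure_def fst_conv snd_conv Inf_empty top_ereal_def)
    then have "\<not> finitely_valued M (risk_measure (TVaR_acceptance M \<alpha>) (s, Y))"
      using positions_const[of "- 1" M] by (force simp: finitely_valued_def)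
    with nonneg_TVaR False show ?thesis
      by (simp add: S)
  qed
qed

end
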